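(* Set $z_1=(0,0)$, $z_2=(1/2,0)$, $z_3=(0,1/2)$, and $\Gamma=\bigcup_{m=1}^3(\mathbb{Z}^2+z_m)$. Then the periodic configuration $\Gamma$ has density $3$, and the Gabor system $\mathcal{G}(h_1,\Gamma)$ with the first Hermite function $h_1$ is not a frame for $L^2(\mathbb{R})$.
   Context: The $n$-th Hermite function is $h_n(t)=(-1)^nC_n e^{\pi t^2}\frac{d^n}{dt^n}\left(e^{-2\pi t^2}\right)$ with $C_n=2^{1/4}/\sqrt{n!(2\pi)^n2^n}$. For $z=(x,\omega)\in\mathbb{R}^2$ the time-frequency shift is $\pi(z)f(t)=e^{2\pi i\omega t}f(t-x)$. For $\Gamma\subset\mathbb{R}^2$, the Gabor system $\mathcal{G}(g,\Gamma)=\{\pi(\gamma)g\mid\gamma\in\Gamma\}$ is a frame for $L^2(\mathbb{R})$ if there are constants $0<A\le B<\infty$ with $A\|f\|_{L^2}^2\le\sum_{\gamma\in\Gamma}|\langle f,\pi(\gamma)g\rangle|^2\le B\|f\|_{L^2}^2$ for all $f\in L^2(\mathbb{R})$. For a lattice $\Lambda\subset\mathbb{R}^2$ and points $z_1,\dots,z_M$ that are pairwise distinct modulo $\Lambda$, the periodic configuration $\bigcup_{m=1}^M(\Lambda+z_m)$ has density $M/\mathrm{vol}(\mathbb{R}^2/\Lambda)$. *)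

theory Defs
  imports "HOL-Analysis.Analysis"
begin

definition hermite_const :: "nat \<Rightarrow> real" where
  "hermite_const n = 2 powr (1/4) / sqrt (fact n * (2 * pi) ^ n * 2 ^ n)"

definition hermite_fun :: "nat \<Rightarrow> real \<Rightarrow> complex" where
  "hermite_fun n t = complex_of_real
     ((-1) ^ n * hermite_const n * exp (pi * t\<^sup>2) * (deriv ^^ n) (\<lambda>s::real. exp (- 2 * pi * s\<^sup>2)) t)"

definition tf_shift :: "real \<times> real \<Rightarrow> (real \<Rightarrow> complex) \<Rightarrow> real \<Rightarrow> complex" where
  "tf_shift = (\<lambda>(x, \<omega>) f t. exp (2 * complex_of_real pi * \<i> * complex_of_real \<omega> * complex_of_real t) * f (t - x))"

(* Elements of L^2(R) are represented by Borel functions rather than by classes modulo null sets;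
   every class has such a representative, and the quantities below do not depend on its choice. *)
definition L2 :: "(real \<Rightarrow> complex) set" where
  "L2 = {f. f \<in> borel_measurable lborel \<and> integrable lborel (\<lambda>t. (cmod (f t))\<^sup>2)}"

definition L2_inner :: "(real \<Rightarrow> complex) \<Rightarrow> (real \<Rightarrow> complex) \<Rightarrow> complex" where
  "L2_inner f g = (LINT t|lborel. f t * cnj (g t))"

definition L2_norm :: "(real \<Rightarrow> complex) \<Rightarrow> real" where
  "L2_norm f = sqrt (LINT t|lborel. (cmod (f t))\<^sup>2)"

(* The sum is taken in ennreal, where it always exists (possibly as infinity), so that the upper
   bound includes its convergence. *)
definition gabor_frame :: "(real \<Rightarrow> complex) \<Rightarrow> (real \<times> real) set \<Rightarrow> bool" where
  "gabor_frame g \<Gamma> \<longleftrightarrow> (\<exists>A B :: real. 0 < A \<and> A \<le> B \<and> (\<forall>f \<in> L2.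
      ennreal (A * (L2_norm f)\<^sup>2) \<le> (\<Sum>\<^sub>\<infinity>\<gamma>\<in>\<Gamma>. ennreal ((cmod (L2_inner f (tf_shift \<gamma> g)))\<^sup>2)) \<and>
      (\<Sum>\<^sub>\<infinity>\<gamma>\<in>\<Gamma>. ennreal ((cmod (L2_inner f (tf_shift \<gamma> g)))\<^sup>2)) \<le> ennreal (B * (L2_norm f)\<^sup>2)))"

definition is_lattice :: "(real \<times> real) set \<Rightarrow> bool" where
  "is_lattice \<Lambda> \<longleftrightarrow> (\<exists>b c. b \<noteq> c \<and> independent {b, c} \<and>
      \<Lambda> = {of_int k *\<^sub>R b + of_int l *\<^sub>R c | k l :: int. True})"

definition fundamental_domain :: "(real \<times> real) set \<Rightarrow> (real \<times> real) set \<Rightarrow> bool" where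
  "fundamental_domain \<Lambda> D \<longleftrightarrow> D \<in> sets borel \<and> (\<forall>x. \<exists>!l. l \<in> \<Lambda> \<and> x - l \<in> D)"

(* vol(R^2/\<Lambda>): for a lattice, all Borel fundamental domains have the same finite area. *)
definition covolume :: "(real \<times> real) set \<Rightarrow> real" where
  "covolume \<Lambda> = (THE v. \<exists>D. fundamental_domain \<Lambda> D \<and> v = measure lborel D)"

definition periodic_configuration ::
  "(real \<times> real) set \<Rightarrow> nat \<Rightarrow> (nat \<Rightarrow> real \<times> real) \<Rightarrow> (real \<times> real) set \<Rightarrow> bool" where
  "periodic_configuration \<Lambda> M z \<Gamma> \<longleftrightarrow> is_lattice \<Lambda> \<and>
      (\<forall>i\<in>{1..M}. \<forall>j\<in>{1..M}. i \<noteq> j \<longrightarrow> z i - z j \<notin> \<Lambda>) \<and>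
      \<Gamma> = (\<Union>m\<in>{1..M}. (\<lambda>l. l + z m) ` \<Lambda>)"

(* The density is attached to the presentation (\<Lambda>, z 1, ..., z M) of a configuration,
   of which it only involves \<Lambda> and M. *)
definition config_density :: "(real \<times> real) set \<Rightarrow> nat \<Rightarrow> real" where
  "config_density \<Lambda> M = real M / covolume \<Lambda>"

end

theory Submission
  imports Defs
begin

text \<open>
  The lower frame bound is violated by approximations of the Dirac comb \<open>\<Sum>j. \<delta>\<^sub>j\<close>. Formally the
  comb is orthogonal to all time-frequency shifts of \<open>h\<^sub>1\<close> over \<open>\<Gamma>\<close>: the coefficient at
  \<open>(k + x, l + \<omega>)\<close> is, up to a phase, \<open>\<Sum>j. \<sigma>\<^sup>j h\<^sub>1 (j - k - x)\<close> with \<open>\<sigma> = exp (- 2 \<pi> i \<omega>)\<close>, and for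
  each of the three shifts \<open>(x, \<omega>)\<close> the terms cancel in pairs because \<open>h\<^sub>1\<close> is odd. (Equivalently,
  the Zak transform of \<open>h\<^sub>1\<close> vanishes at three half-integer points.) Replacing the comb
  by \<open>f\<^sub>N = \<Sum>j<N. 1\<^bsub>[j, j + 1/N]\<^esub>\<close>, which satisfies \<open>\<parallel>f\<^sub>N\<parallel>\<^sup>2 \<ge> 1\<close>, the truncation costs only boundary
  terms, because the antisymmetric rapidly decaying sequence \<open>\<sigma>\<^sup>i h\<^sub>1 (i - x)\<close> is the
  difference of a rapidly decaying sequence; the thickening is controlled by the Lipschitz bound
  for \<open>h\<^sub>1\<close>. Together the sum of squared coefficients is \<open>O(1/N)\<close>.
\<close>

section \<open>Geometric weights on the integers and telescoping of antisymmetric sequences\<close>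

lemma sum_half_power_abs_le:
  fixes I :: "int set"
  assumes "finite I"
  shows "(\<Sum>i\<in>I. (1/2::real) ^ nat \<bar>i\<bar>) \<le> 3"
proof -
  \<comment> \<open>The closed form over symmetric intervals increases to 1 + 2 * (1/2 + 1/4 + ...)
    = 3; every finite set of integers lies in such an interval.\<close>
  have box: "(\<Sum>i\<in>{- int n..int n}. (1/2::real) ^ nat \<bar>i\<bar>) = 3 - 2 * (1/2) ^ n" for n
  proof (induction n)
    case (Suc n)
    have "{- int (Suc n)..int (Suc n)} = insert (int (Suc n)) (insert (- int (Suc n)) {- int n..int n})"
      by auto
    then show ?case using Suc by (simp add: nat_add_distrib)
  qed simp
  obtain n where n: "\<And>i. i \<in> I \<Longrightarrow> \<bar>i\<bar> \<le> int n"
  proof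
    fix i assume "i \<in> I"
    then have "nat \<bar>i\<bar> \<le> (\<Sum>i\<in>I. nat \<bar>i\<bar>)"
      using assms by (intro member_le_sum) auto
    then show "\<bar>i\<bar> \<le> int (\<Sum>i\<in>I. nat \<bar>i\<bar>)" by linarith
  qed
  have "(\<Sum>i\<in>I. (1/2::real) ^ nat \<bar>i\<bar>) \<le> (\<Sum>i\<in>{- int n..int n}. (1/2::real) ^ nat \<bar>i\<bar>)"
    using n by (intro sum_mono2) (auto simp: abs_le_iff minus_le_iff)
  also have "\<dots> \<le> 3" unfolding box by simp
  finally show ?thesis .
qed

lemma sum_half_power_shift_le:
  fixes K :: "int set"
  assumes "finite K"
  shows "(\<Sum>k\<in>K. (1/2::real) ^ nat \<bar>a - k\<bar>) \<le> 3"
proof -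
  have "(\<Sum>k\<in>K. (1/2::real) ^ nat \<bar>a - k\<bar>) = (\<Sum>i\<in>(\<lambda>k. a - k) ` K. (1/2::real) ^ nat \<bar>i\<bar>)"
    by (subst sum.reindex) (auto simp: inj_on_def)
  also have "\<dots> \<le> 3" using assms by (intro sum_half_power_abs_le) auto
  finally show ?thesis .
qed

lemma int_constant_if_step:
  fixes f :: "int \<Rightarrow> 'a"
  assumes "\<And>m. f (m + 1) = f m"
  shows "f m = f 0"
proof (induction m rule: int_induct[where k = 0])
  case (step2 i)
  then show ?case using assms[of "i - 1"] by simp
qed (auto simp: assms)

text \<open>An exponentially decaying sequence has a decaying antidifference when its total sum
  vanishes, and antisymmetry about \<open>s / 2\<close> forces this by pairing \<open>i\<close> with
  \<open>s - i\<close>. The antidifference is the left tail sum, which decays to the left at once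
  and to the right by reflection.\<close>

lemma antisymmetric_decay_antidifference:
  fixes u :: "int \<Rightarrow> real"
  assumes anti: "\<And>i. u (s - i) = - u i" and s: "s = 0 \<or> s = 1"
    and decay: "\<And>i. \<bar>u i\<bar> \<le> C * (1/2) ^ nat \<bar>i\<bar>"
  obtains T where "\<And>m. T (m + 1) - T m = u m" and "\<And>m. \<bar>T m\<bar> \<le> 16 * C * (1/2) ^ nat \<bar>m\<bar>"
proof -
  define T where "T m = (\<Sum>n. u (m - 1 - int n))" for m
  have C: "C \<ge> 0" using decay[of 0] by simp
  \<comment> \<open>For \<open>m \<le> 1\<close> all indices \<open>m - 1 - int n\<close> are at
    most 0, so their absolute value is \<open>1 - m + n\<close>, which is at least
    \<open>\<bar>m\<bar> + n - 1\<close>; the lost unit gives the factor 2.\<close>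
  have bd: "\<bar>u (m - 1 - int n)\<bar> \<le> 2 * C * (1/2) ^ nat \<bar>m\<bar> * (1/2) ^ n" if "m \<le> 1" for m n
  proof -
    have "nat \<bar>m - 1 - int n\<bar> + 1 \<ge> nat \<bar>m\<bar> + n" using that by linarith
    then have "(1/2::real) ^ (nat \<bar>m - 1 - int n\<bar> + 1) \<le> (1/2) ^ (nat \<bar>m\<bar> + n)"
      by (intro power_decreasing) auto
    then have "(1/2::real) ^ (nat \<bar>m - 1 - int n\<bar>) \<le> 2 * ((1/2) ^ nat \<bar>m\<bar> * (1/2) ^ n)"
      by (simp add: power_add)
    from mult_left_mono[OF this C] show ?thesis using decay[of "m - 1 - int n"] by (simp add: mult_ac)
  qed
  have geo: "(\<lambda>n. 2 * C * (1/2) ^ nat \<bar>m\<bar> * (1/2) ^ n) sums (4 * C * (1/2) ^ nat \<bar>m\<bar>)" for m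
    using sums_mult[OF geometric_sums[of "1/2::real"], of "2 * C * (1/2) ^ nat \<bar>m\<bar>"] by (simp add: mult_ac)
  have summ1: "summable (\<lambda>n. u (m - 1 - int n))" if "m \<le> 1" for m
    by (rule summable_comparison_test[OF _ sums_summable[OF geo[of m]]]) (use bd[OF that] in auto)
  have summ: "summable (\<lambda>n. u (m - 1 - int n))" for m
  proof -
    \<comment> \<open>Dropping the first \<open>nat m\<close> terms moves the starting point to
      \<open>m - int (nat m) \<le> 0\<close>, where \<open>summ1\<close> applies.\<close>
    have "summable (\<lambda>n. u (m - 1 - int (n + nat m)))"
      using summ1[of "m - int (nat m)"] by (simp add: algebra_simps)
    then show ?thesis by (subst (asm) summable_iff_shift)
  qed
  have step: "T (m + 1) - T m = u m" for m
    unfolding T_def using suminf_split_head[OF summ[of "m + 1"]] by (simp add: algebra_simps)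
  have small: "\<bar>T m\<bar> \<le> 4 * C * (1/2) ^ nat \<bar>m\<bar>" if "m \<le> 1" for m
  proof -
    have "norm (T m) \<le> (\<Sum>n. 2 * C * (1/2) ^ nat \<bar>m\<bar> * (1/2) ^ n)"
      unfolding T_def using bd[OF that] by (intro norm_suminf_le sums_summable[OF geo]) auto
    then show ?thesis using sums_unique[OF geo[of m]] by simp
  qed
  (* The two tails agree by antisymmetry, so the bound for m <= 1 reflects to all m. *)
  define D where "D m = T m - T (s + 1 - m)" for m
  have "D (m + 1) = D m" for m
    unfolding D_def using step[of m] step[of "s - m"] anti[of m] by (simp add: algebra_simps)
  then have D: "D m = D 0" for m by (rule int_constant_if_step)
  \<comment> \<open>The reflection taking \<open>m\<close> to \<open>s + 1 - m\<close> exchanges the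
    two terms of \<open>D\<close>, so the constant value of \<open>D\<close> equals its own
    negative.\<close>
  have "D (s + 1) = - D 0" unfolding D_def by simp
  with D[of "s + 1"] have "D 0 = 0" by simp
  with D have sym: "T m = T (s + 1 - m)" for m unfolding D_def by (metis eq_iff_diff_eq_0)
  have "\<bar>T m\<bar> \<le> 16 * C * (1/2) ^ nat \<bar>m\<bar>" for m
  proof (cases "m \<le> 1")
    case True
    have "4 * C * (1/2) ^ nat \<bar>m\<bar> \<le> 16 * C * (1/2) ^ nat \<bar>m\<bar>"
      using C by (intro mult_right_mono) auto
    then show ?thesis using small[OF True] by linarith
  next
    case False
    \<comment> \<open>Reflecting shortens the exponent by \<open>s + 1\<close>, at most 2. This
      costs a factor 4 on top of \<open>4 * C\<close>, whence the 16.\<close>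
    have "nat \<bar>s + 1 - m\<bar> + 2 \<ge> nat \<bar>m\<bar>" using False s by linarith
    then have "(1/2::real) ^ (nat \<bar>s + 1 - m\<bar> + 2) \<le> (1/2) ^ nat \<bar>m\<bar>"
      by (intro power_decreasing) auto
    then have "(1/2::real) ^ nat \<bar>s + 1 - m\<bar> \<le> 4 * (1/2) ^ nat \<bar>m\<bar>"
      by (simp add: power_add power2_eq_square)
    from mult_left_mono[OF this, of "4 * C"] C show ?thesis
      using small[of "s + 1 - m"] sym[of m] False s by auto
  qed
  with step show ?thesis by (rule that)
qed

text \<open>At \<open>t = 0\<close> the inner sum telescopes to two boundary terms; moving to
  \<open>t\<close> adds a Lipschitz error whose squares sum to \<open>O(t\<^sup>2 * N)\<close>,
  bounded because \<open>t * real N \<le> 1\<close>. The condition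
  \<open>\<sigma> powi s = 1\<close> excludes the fourth half-integer point \<open>x = 1/2\<close>,
  \<open>\<sigma> = -1\<close>, where the sequence is symmetric instead of antisymmetric.\<close>

lemma alternating_translates_sum_squares_bound:
  fixes G :: "real \<Rightarrow> real" and s :: int
  assumes odd: "\<And>t. G (- t) = - G t"
    and s: "s = 0 \<or> s = 1" and \<sigma>: "\<sigma> = 1 \<or> \<sigma> = -1" and \<sigma>s: "\<sigma> powi s = 1" and x: "2 * x = of_int s"
    and decay: "\<And>i::int. \<bar>G (of_int i - x)\<bar> \<le> C * (1/2) ^ nat \<bar>i\<bar>"
    and lip: "\<And>(i::int) t. 0 \<le> t \<Longrightarrow> t \<le> 1 \<Longrightarrow>
      \<bar>G (t + of_int i - x) - G (of_int i - x)\<bar> \<le> C * t * (1/2) ^ nat \<bar>i\<bar>"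
  obtains B where "\<And>(N::nat) (K::int set) t. 1 \<le> N \<Longrightarrow> finite K \<Longrightarrow> 0 \<le> t \<Longrightarrow> t * real N \<le> 1 \<Longrightarrow>
    (\<Sum>k\<in>K. (\<Sum>j<N. \<sigma> ^ j * G (t + real j - of_int k - x))\<^sup>2) \<le> B"
proof -
  have C: "C \<ge> 0" using decay[of 0] by simp
  have \<sigma>0: "\<sigma> \<noteq> 0" and \<sigma>abs: "\<bar>\<sigma>\<bar> = 1" using \<sigma> by auto
  have \<sigma>neg: "\<sigma> powi (- i) = \<sigma> powi i" for i
    using \<sigma> by (auto simp: power_int_minus_one_minus simp del: power_int_minus)
  define w :: "int \<Rightarrow> real" where "w i = (1/2) ^ nat \<bar>i\<bar>" for i
  have w0: "0 \<le> w i" and w1: "w i \<le> 1" for i by (auto simp: w_def power_le_one)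
  have wsum: "(\<Sum>k\<in>K. w (a - k)) \<le> 3" if "finite K" for K a
    using sum_half_power_shift_le[OF that, of a] by (simp add: w_def)
  have wsum': "(\<Sum>j<N. w (int j - k)) \<le> 3" for N k
  proof -
    have "(\<Sum>j<N. w (int j - k)) = (\<Sum>j\<in>int ` {..<N}. w (k - j))"
      by (subst sum.reindex) (auto simp: w_def abs_minus_commute)
    then show ?thesis using wsum by simp
  qed
  define u where "u i = \<sigma> powi i * G (of_int i - x)" for i
  have "u (s - i) = - u i" for i
  proof -
    have "real_of_int (s - i) - x = - (real_of_int i - x)" using x by simp
    moreover have "\<sigma> powi (s - i) = \<sigma> powi i"
      using \<sigma>0 \<sigma>s \<sigma>neg[of i] power_int_add[of \<sigma> s "- i"] by simp
    ultimately show ?thesis unfolding u_def using odd[of "of_int i - x"] by simp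
  qed
  moreover have "\<bar>u i\<bar> \<le> C * (1/2) ^ nat \<bar>i\<bar>" for i
    using decay[of i] \<sigma>abs by (simp add: u_def abs_mult power_int_abs)
  ultimately obtain T where T: "\<And>m. T (m + 1) - T m = u m"
    and "\<And>m. \<bar>T m\<bar> \<le> 16 * C * (1/2) ^ nat \<bar>m\<bar>"
    using antisymmetric_decay_antidifference[of u s C] s by metis
  then have Tw: "\<bar>T m\<bar> \<le> 16 * C * w m" for m by (simp add: w_def)
  have T2: "(T m)\<^sup>2 \<le> (16 * C)\<^sup>2 * w m" for m
  proof -
    have "(T m)\<^sup>2 \<le> (16 * C * w m)\<^sup>2" using power_mono[OF Tw[of m], of 2] by simp
    also have "\<dots> = (16 * C)\<^sup>2 * (w m * w m)" by (simp add: power2_eq_square)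
    also have "\<dots> \<le> (16 * C)\<^sup>2 * (w m * 1)" using w0 w1 by (intro mult_left_mono) auto
    finally show ?thesis by simp
  qed
  show ?thesis
  proof (rule that)
    fix N :: nat and K :: "int set" and t :: real
    assume N: "1 \<le> N" and K: "finite K" and t: "0 \<le> t" and tN: "t * real N \<le> 1"
    have t1: "t \<le> 1"
      using mult_left_mono[of 1 "real N" t] N t tN by simp
    have pw: "(\<Sum>j<N. \<sigma> ^ j * G (t + real j - of_int k - x))\<^sup>2
        \<le> 4 * (16 * C)\<^sup>2 * (w (int N - k) + w (0 - k)) + 6 * C\<^sup>2 * t * t * (\<Sum>j<N. w (int j - k))" for k
    proof -
      \<comment> \<open>\<open>a\<close> is the sum at the grid points and \<open>b\<close> the
        error of moving them by \<open>t\<close>.\<close>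
      define a where "a = (\<Sum>j<N. \<sigma> ^ j * G (of_int (int j - k) - x))"
      define b where "b = (\<Sum>j<N. \<sigma> ^ j * (G (t + of_int (int j - k) - x) - G (of_int (int j - k) - x)))"
      have ab: "(\<Sum>j<N. \<sigma> ^ j * G (t + real j - of_int k - x)) = a + b"
        unfolding a_def b_def sum.distrib[symmetric]
        by (intro sum.cong refl) (simp add: algebra_simps)
      \<comment> \<open>The factor \<open>\<sigma> powi k\<close> has modulus 1, so after
        telescoping \<open>T\<close> only the ends \<open>j = N\<close> and \<open>j = 0\<close>
        contribute to \<open>a\<^sup>2\<close>.\<close>
      have "a = \<sigma> powi k * (\<Sum>j<N. u (int j - k))"
        unfolding a_def sum_distrib_left u_def
        using \<sigma>0 by (intro sum.cong refl) (simp add: power_int_diff)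
      also have "(\<Sum>j<N. u (int j - k)) = (\<Sum>j<N. T (int (Suc j) - k) - T (int j - k))"
        using T[symmetric] by (intro sum.cong refl) (simp add: algebra_simps)
      also have "\<dots> = T (int N - k) - T (0 - k)"
        using sum_lessThan_telescope[of "\<lambda>j. T (int j - k)" N] by simp
      finally have "a\<^sup>2 = (T (int N - k) - T (0 - k))\<^sup>2"
        using \<sigma>abs by (metis (no_types) abs_mult mult_1 power2_abs power_int_abs power_int_1_left)
      also have "\<dots> \<le> 2 * (T (int N - k))\<^sup>2 + 2 * (T (0 - k))\<^sup>2"
        using zero_le_power2[of "T (int N - k) + T (0 - k)"] by (simp add: power2_eq_square algebra_simps)
      finally have a: "a\<^sup>2 \<le> 2 * (16 * C)\<^sup>2 * (w (int N - k) + w (0 - k))"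
        using T2[of "int N - k"] T2[of "0 - k"] unfolding distrib_left by linarith
      define W where "W = (\<Sum>j<N. w (int j - k))"
      have W: "0 \<le> W" "W \<le> 3" using w0 wsum' by (auto simp: W_def sum_nonneg)
      have "\<bar>b\<bar> \<le> (\<Sum>j<N. C * t * w (int j - k))"
        unfolding b_def w_def
      proof (intro order_trans[OF sum_abs] sum_mono)
        fix j
        show "\<bar>\<sigma> ^ j * (G (t + of_int (int j - k) - x) - G (of_int (int j - k) - x))\<bar>
            \<le> C * t * (1/2) ^ nat \<bar>int j - k\<bar>"
          unfolding abs_mult power_abs \<sigma>abs power_one mult_1 by (rule lip[OF t t1])
      qed
      then have "\<bar>b\<bar> \<le> C * t * W" by (simp add: W_def sum_distrib_left)
      then have "b\<^sup>2 \<le> (C * t * W)\<^sup>2" using power_mono[of "\<bar>b\<bar>" _ 2] by simp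
      also have "\<dots> = C\<^sup>2 * t * t * (W * W)" by (simp add: power2_eq_square)
      \<comment> \<open>Only one factor \<open>W\<close> is replaced by 3. The other is kept so that
        summing over \<open>k\<close> yields a multiple of \<open>N\<close>, independent of the size
        of \<open>K\<close>.\<close>
      also have "\<dots> \<le> C\<^sup>2 * t * t * (3 * W)" using W t by (intro mult_left_mono mult_right_mono) auto
      finally have b: "b\<^sup>2 \<le> 3 * C\<^sup>2 * t * t * W" by simp
      have "(a + b)\<^sup>2 \<le> 2 * a\<^sup>2 + 2 * b\<^sup>2"
        using zero_le_power2[of "a - b"] by (simp add: power2_eq_square algebra_simps)
      also have "\<dots> \<le> 4 * (16 * C)\<^sup>2 * (w (int N - k) + w (0 - k)) + 6 * C\<^sup>2 * t * t * W"
        using a b by linarith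
      finally show ?thesis by (simp add: ab W_def)
    qed
    have "(\<Sum>k\<in>K. \<Sum>j<N. w (int j - k)) = (\<Sum>j<N. \<Sum>k\<in>K. w (int j - k))" by (rule sum.swap)
    also have "\<dots> \<le> (\<Sum>j<N. 3)" using wsum[OF K] by (intro sum_mono)
    finally have WK: "(\<Sum>k\<in>K. \<Sum>j<N. w (int j - k)) \<le> 3 * real N" by simp
    have "(\<Sum>k\<in>K. (\<Sum>j<N. \<sigma> ^ j * G (t + real j - of_int k - x))\<^sup>2)
        \<le> (\<Sum>k\<in>K. 4 * (16 * C)\<^sup>2 * (w (int N - k) + w (0 - k)) + 6 * C\<^sup>2 * t * t * (\<Sum>j<N. w (int j - k)))"
      by (intro sum_mono pw)
    also have "\<dots> = 4 * (16 * C)\<^sup>2 * ((\<Sum>k\<in>K. w (int N - k)) + (\<Sum>k\<in>K. w (0 - k)))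
        + 6 * C\<^sup>2 * t * t * (\<Sum>k\<in>K. \<Sum>j<N. w (int j - k))"
      by (simp only: sum.distrib sum_distrib_left[symmetric])
    also have "\<dots> \<le> 4 * (16 * C)\<^sup>2 * (3 + 3) + 6 * C\<^sup>2 * t * t * (3 * real N)"
      using WK t by (intro add_mono mult_left_mono wsum[OF K]) auto
    \<comment> \<open>One factor \<open>t\<close> absorbs \<open>N\<close>, the other is at most
      1.\<close>
    also have "6 * C\<^sup>2 * t * t * (3 * real N) = 18 * C\<^sup>2 * (t * (t * real N))" by simp
    also have "\<dots> \<le> 18 * C\<^sup>2 * (1 * 1)"
      using t t1 tN by (intro mult_left_mono mult_mono) auto
    finally show "(\<Sum>k\<in>K. (\<Sum>j<N. \<sigma> ^ j * G (t + real j - of_int k - x))\<^sup>2)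
      \<le> 4 * (16 * C)\<^sup>2 * (3 + 3) + 18 * C\<^sup>2 * (1 * 1)" by simp
  qed
qed

section \<open>Bessel's inequality and Fourier coefficients on the unit interval\<close>

lemma Bessel_inequality_finite:
  fixes e :: "'i \<Rightarrow> 'a \<Rightarrow> complex"
  assumes "finite I"
    and orth: "\<And>i j. i \<in> I \<Longrightarrow> j \<in> I \<Longrightarrow>
      has_bochner_integral M (\<lambda>x. e i x * cnj (e j x)) (if i = j then 1 else 0)"
    and f2: "integrable M (\<lambda>x. (cmod (f x))\<^sup>2)"
    and fe: "\<And>i. i \<in> I \<Longrightarrow> integrable M (\<lambda>x. f x * cnj (e i x))"
  shows "(\<Sum>i\<in>I. (cmod (LINT x|M. f x * cnj (e i x)))\<^sup>2) \<le> (LINT x|M. (cmod (f x))\<^sup>2)"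
proof -
  define c where "c i = (LINT x|M. f x * cnj (e i x))" for i
  \<comment> \<open>The residual of the orthogonal projection onto the span of the
    \<open>e i\<close>. Expanding its squared norm gives \<open>?F\<close> minus the sum of the
    squared coefficients, and this is nonnegative.\<close>
  define r where "r x = f x - (\<Sum>i\<in>I. c i * e i x)" for x
  let ?F = "LINT x|M. (cmod (f x))\<^sup>2"
  have fe': "has_bochner_integral M (\<lambda>x. f x * cnj (e i x)) (c i)" if "i \<in> I" for i
    unfolding c_def by (rule has_bochner_integral_integrable[OF fe[OF that]])
  have fe'': "has_bochner_integral M (\<lambda>x. cnj (f x) * e i x) (cnj (c i))" if "i \<in> I" for i
    using has_bochner_integral_cnj[OF fe'[OF that]] by simp
  have f2': "has_bochner_integral M (\<lambda>x. f x * cnj (f x)) (of_real ?F)"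
    using has_bochner_integral_of_real[OF has_bochner_integral_integrable[OF f2], where ?'a = complex]
    by (simp only: complex_norm_square)
  have r2: "r x * cnj (r x) = f x * cnj (f x) - (\<Sum>i\<in>I. c i * (cnj (f x) * e i x))
      - (\<Sum>i\<in>I. cnj (c i) * (f x * cnj (e i x)))
      + (\<Sum>i\<in>I. \<Sum>j\<in>I. (c i * cnj (c j)) * (e i x * cnj (e j x)))" for x
  proof -
    define S where "S = (\<Sum>i\<in>I. c i * e i x)"
    have "r x * cnj (r x) = f x * cnj (f x) - S * cnj (f x) - cnj S * f x + S * cnj S"
      unfolding r_def S_def by (simp add: algebra_simps)
    also have "S * cnj S = (\<Sum>i\<in>I. \<Sum>j\<in>I. (c i * cnj (c j)) * (e i x * cnj (e j x)))"
      unfolding S_def cnj_sum sum_product by (simp add: mult_ac)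
    finally show ?thesis unfolding S_def cnj_sum sum_distrib_right by (simp add: mult_ac)
  qed
  have "has_bochner_integral M (\<lambda>x. r x * cnj (r x))
     (of_real ?F - (\<Sum>i\<in>I. c i * cnj (c i)) - (\<Sum>i\<in>I. cnj (c i) * c i)
       + (\<Sum>i\<in>I. \<Sum>j\<in>I. (c i * cnj (c j)) * (if i = j then 1 else 0)))"
    unfolding r2
    by (intro has_bochner_integral_add has_bochner_integral_diff f2' has_bochner_integral_sum
        has_bochner_integral_mult_right orth fe' fe'')
  also have "(\<Sum>i\<in>I. \<Sum>j\<in>I. (c i * cnj (c j)) * (if i = j then 1 else 0)) = (\<Sum>i\<in>I. c i * cnj (c i))"
    using \<open>finite I\<close> by (simp add: if_distrib cong: if_cong)
  finally have "has_bochner_integral M (\<lambda>x. of_real ((cmod (r x))\<^sup>2) :: complex)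
      (of_real (?F - (\<Sum>i\<in>I. (cmod (c i))\<^sup>2)))"
    unfolding of_real_diff of_real_sum complex_norm_square by (simp add: mult.commute)
  then have "has_bochner_integral M (\<lambda>x. (cmod (r x))\<^sup>2) (?F - (\<Sum>i\<in>I. (cmod (c i))\<^sup>2))"
    using has_bochner_integral_Re by fastforce
  then have "(LINT x|M. (cmod (r x))\<^sup>2) = ?F - (\<Sum>i\<in>I. (cmod (c i))\<^sup>2)"
    by (rule has_bochner_integral_integral_eq)
  moreover have "0 \<le> (LINT x|M. (cmod (r x))\<^sup>2)" by simp
  ultimately have "0 \<le> ?F - (\<Sum>i\<in>I. (cmod (c i))\<^sup>2)" by simp
  then show ?thesis unfolding c_def by simp
qed

text \<open>The indicator extends the Fourier characters of \<open>[0, 1]\<close> by zero, so that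
  they are orthonormal for \<open>lborel\<close> and all integrals can stay on the whole
  line.\<close>

definition char_unit :: "int \<Rightarrow> real \<Rightarrow> complex" where
  "char_unit l t = indicator {0..1} t *\<^sub>R exp (2 * of_real pi * \<i> * of_int l * of_real t)"

lemma char_unit_orthonormal:
  "has_bochner_integral lborel (\<lambda>t. char_unit l t * cnj (char_unit m t)) (if l = m then 1 else 0)"
proof -
  define a where "a = 2 * of_real pi * \<i> * of_int (l - m)"
  have eq: "char_unit l t * cnj (char_unit m t) = indicator {0..1} t *\<^sub>R exp (a * of_real t)" for t
    by (auto simp: char_unit_def a_def indicator_def exp_cnj simp flip: exp_add) (simp add: algebra_simps)
  show ?thesis
  proof (cases "l = m")
    case True
    have "has_bochner_integral lborel (\<lambda>t::real. indicator {0..1} t *\<^sub>R (1 :: complex)) (of_real 1 - of_real 0)"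
      by (intro has_bochner_integral_FTC_Icc[of 0 1 complex_of_real "\<lambda>_. 1"])
        (auto intro!: has_vector_derivative_of_real derivative_eq_intros)
    then show ?thesis using True unfolding eq by (simp add: a_def)
  next
    case False
    then have a: "a \<noteq> 0" by (simp add: a_def)
    have "has_bochner_integral lborel (\<lambda>t. indicator {0..1} t *\<^sub>R exp (a * of_real t))
       (exp (a * of_real 1) / a - exp (a * of_real 0) / a)"
      using a by (intro has_bochner_integral_FTC_Icc[where F = "\<lambda>t. exp (a * of_real t) / a"])
        (auto intro!: derivative_eq_intros continuous_intros has_vector_derivative_real_field)
    moreover have "exp a = 1"
      unfolding a_def using exp_integer_2pi[of "of_int (l - m)"] by (simp add: mult_ac)
    ultimately show ?thesis using False unfolding eq by simp
  qed
qed

text \<open>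
  On the support of the test function, the Gabor coefficients with fixed \<open>k\<close> are the Fourier
  coefficients on \<open>[0, 1]\<close> of one function of modulus
  \<open>\<bar>\<Sum>j<N. \<sigma>\<^sup>j G (t + j - k - x)\<bar>\<close>, so Bessel's inequality sums them over \<open>l\<close>.
\<close>

lemma sum_gabor_coefficients_indicator_le:
  fixes G :: "real \<Rightarrow> real"
  assumes cont: "continuous_on UNIV G" and N: "1 \<le> N" and "finite K" "finite L"
    and \<sigma>: "cnj (exp (2 * of_real pi * \<i> * of_real \<omega>)) = complex_of_real \<sigma>"
    and bound: "\<And>t. 0 \<le> t \<Longrightarrow> t * real N \<le> 1 \<Longrightarrow>
      (\<Sum>k\<in>K. (\<Sum>j<N. \<sigma> ^ j * G (t + real j - of_int k - x))\<^sup>2) \<le> B"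
  shows "(\<Sum>k\<in>K. \<Sum>l\<in>L. (cmod (L2_inner (\<lambda>t. \<Sum>j<N. indicator {real j..real j + 1 / real N} t)
      (tf_shift (of_int k + x, of_int l + \<omega>) (\<lambda>t. of_real (G t)))))\<^sup>2) \<le> B / real N"
proof -
  have GC: "continuous_on A (\<lambda>t. G (h t))" if "continuous_on A h" for h A
    using continuous_on_compose2[OF cont that] by simp
  define S where "S k t = (\<Sum>j<N. \<sigma> ^ j * G (t + real j - of_int k - x))" for k t
  \<comment> \<open>\<open>F k\<close> superposes the contributions of all intervals
    \<open>[j, j + 1/N]\<close>, translated to \<open>[0, 1/N]\<close>; the
    \<open>l\<close>-dependent phase is left to \<open>char_unit l\<close>.\<close>
  define F where "F k t = indicator {0..1 / real N} t *\<^sub>R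
    (cnj (exp (2 * of_real pi * \<i> * of_real \<omega> * of_real t)) * of_real (S k t))" for k t
  have contS: "continuous_on A (S k)" for A k
    unfolding S_def by (intro continuous_intros GC)
  \<comment> \<open>Keeps the support of \<open>F k\<close> inside \<open>[0, 1]\<close>, where the
    cutoff in \<open>char_unit\<close> is invisible.\<close>
  have N1: "1 / real N \<le> 1" using N by simp
  have inner: "L2_inner (\<lambda>t. \<Sum>j<N. indicator {real j..real j + 1 / real N} t)
      (tf_shift (of_int k + x, of_int l + \<omega>) (\<lambda>t. of_real (G t)))
      = (LINT t|lborel. F k t * cnj (char_unit l t))" for k l
  proof -
    define H where "H t = cnj (exp (2 * of_real pi * \<i> * of_real (of_int l + \<omega>) * of_real t)
      * of_real (G (t - (of_int k + x))))" for t
    have contH: "continuous_on A H" for A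
      unfolding H_def by (intro continuous_intros GC)
    have intH: "integrable lborel (\<lambda>t. indicator {a..b} t *\<^sub>R H t)" for a b
      by (intro borel_integrable_compact contH compact_Icc)
    have "L2_inner (\<lambda>t. \<Sum>j<N. indicator {real j..real j + 1 / real N} t)
      (tf_shift (of_int k + x, of_int l + \<omega>) (\<lambda>t. of_real (G t)))
      = (LINT t|lborel. (\<Sum>j<N. indicator {real j..real j + 1 / real N} t *\<^sub>R H t))"
      unfolding L2_inner_def
    proof (intro Bochner_Integration.integral_cong refl)
      fix t
      have "cnj (tf_shift (of_int k + x, of_int l + \<omega>) (\<lambda>t. of_real (G t)) t) = H t"
        unfolding tf_shift_def H_def by simp
      then show "(\<Sum>j<N. indicator {real j..real j + 1 / real N} t) *
          cnj (tf_shift (of_int k + x, of_int l + \<omega>) (\<lambda>t. of_real (G t)) t)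
          = (\<Sum>j<N. indicator {real j..real j + 1 / real N} t *\<^sub>R H t)"
        by (simp only: sum_distrib_right) (intro sum.cong refl, simp split: split_indicator)
    qed
    also have "\<dots> = (\<Sum>j<N. LINT t|lborel. indicator {real j..real j + 1 / real N} t *\<^sub>R H t)"
      by (intro Bochner_Integration.integral_sum intH)
    also have "\<dots> = (\<Sum>j<N. LINT t|lborel. indicator {0..1 / real N} t *\<^sub>R H (real j + t))"
    proof (intro sum.cong refl)
      fix j
      show "(LINT t|lborel. indicator {real j..real j + 1 / real N} t *\<^sub>R H t)
          = (LINT t|lborel. indicator {0..1 / real N} t *\<^sub>R H (real j + t))"
        by (subst lborel_integral_real_affine[where c = 1 and t = "real j"])
          (auto simp: indicator_def intro!: Bochner_Integration.integral_cong)
    qed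
    also have "\<dots> = (LINT t|lborel. (\<Sum>j<N. indicator {0..1 / real N} t *\<^sub>R H (real j + t)))"
    proof (intro Bochner_Integration.integral_sum[symmetric] borel_integrable_compact compact_Icc)
      fix j
      show "continuous_on {0..1 / real N} (\<lambda>t. H (real j + t))"
        by (rule continuous_on_compose2[OF contH[of UNIV]]) (auto intro!: continuous_intros)
    qed
    also have "\<dots> = (LINT t|lborel. F k t * cnj (char_unit l t))"
    proof (intro Bochner_Integration.integral_cong refl)
      fix t
      have "H (real j + t) = cnj (exp (2 * of_real pi * \<i> * of_real \<omega> * of_real t))
        * of_real (\<sigma> ^ j * G (t + real j - of_int k - x))
        * cnj (exp (2 * of_real pi * \<i> * of_int l * of_real t))" for j
      proof -
        have "exp (2 * of_real pi * \<i> * of_real (of_int l + \<omega>) * of_real (real j + t))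
          = exp (2 * of_real pi * \<i> * of_int (l * int j)) * exp (of_nat j * (2 * of_real pi * \<i> * of_real \<omega>))
            * exp (2 * of_real pi * \<i> * of_real \<omega> * of_real t) * exp (2 * of_real pi * \<i> * of_int l * of_real t)"
          unfolding exp_add[symmetric] by (simp add: algebra_simps)
        \<comment> \<open>Because \<open>l\<close> and \<open>j\<close> are integers, translating by
          \<open>j\<close> changes the phase only through \<omega>, and its conjugate contributes
          \<open>\<sigma> ^ j\<close>.\<close>
        also have "exp (2 * of_real pi * \<i> * of_int (l * int j)) = 1"
          using exp_integer_2pi[of "of_int (l * int j)"] by (simp add: mult_ac)
        also have "exp (of_nat j * (2 * of_real pi * \<i> * of_real \<omega>)) = exp (2 * of_real pi * \<i> * of_real \<omega>) ^ j"
          by (rule exp_of_nat_mult)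
        finally show ?thesis
          unfolding H_def using \<sigma> by (simp add: algebra_simps)
      qed
      then have "(\<Sum>j<N. H (real j + t)) = cnj (exp (2 * of_real pi * \<i> * of_real \<omega> * of_real t))
          * of_real (S k t) * cnj (exp (2 * of_real pi * \<i> * of_int l * of_real t))"
        unfolding S_def by (simp add: sum_distrib_left sum_distrib_right)
      then show "(\<Sum>j<N. indicator {0..1 / real N} t *\<^sub>R H (real j + t)) = F k t * cnj (char_unit l t)"
        unfolding scaleR_sum_right[symmetric] F_def char_unit_def
        using N1 by (auto simp: indicator_def)
    qed
    finally show ?thesis .
  qed
  have F2: "(cmod (F k t))\<^sup>2 = indicator {0..1 / real N} t *\<^sub>R (S k t)\<^sup>2" for k t
    unfolding F_def by (auto simp: indicator_def norm_mult)
  have intF2: "integrable lborel (\<lambda>t. (cmod (F k t))\<^sup>2)" for k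
    unfolding F2 by (intro borel_integrable_compact compact_Icc continuous_intros contS)
  have Fe: "integrable lborel (\<lambda>t. F k t * cnj (char_unit l t))" for k l
  proof -
    have "F k t * cnj (char_unit l t) = indicator {0..1 / real N} t *\<^sub>R
       (cnj (exp (2 * of_real pi * \<i> * of_real \<omega> * of_real t)) * of_real (S k t)
         * cnj (exp (2 * of_real pi * \<i> * of_int l * of_real t)))" for t
      unfolding F_def char_unit_def using N1 by (auto simp: indicator_def)
    then show ?thesis
      by (simp only:) (intro borel_integrable_compact compact_Icc continuous_intros contS)
  qed
  have "(\<Sum>k\<in>K. \<Sum>l\<in>L. (cmod (LINT t|lborel. F k t * cnj (char_unit l t)))\<^sup>2)
      \<le> (\<Sum>k\<in>K. (LINT t|lborel. (cmod (F k t))\<^sup>2))"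
    by (intro sum_mono Bessel_inequality_finite \<open>finite L\<close> char_unit_orthonormal intF2 Fe)
  \<comment> \<open>With the sum over \<open>k\<close> inside the integral, the bound
    \<open>B\<close>, uniform in \<open>t\<close>, is integrated over an interval of length
    \<open>1 / real N\<close>; this produces the decay in \<open>N\<close>.\<close>
  also have "\<dots> = (LINT t|lborel. (\<Sum>k\<in>K. (cmod (F k t))\<^sup>2))"
    by (intro Bochner_Integration.integral_sum[symmetric] intF2)
  also have "\<dots> \<le> (LINT t|lborel. B * indicator {0..1 / real N} t)"
  proof (intro integral_mono Bochner_Integration.integrable_sum intF2)
    fix t
    show "(\<Sum>k\<in>K. (cmod (F k t))\<^sup>2) \<le> B * indicator {0..1 / real N} t"
      using bound[of t] N unfolding F2 S_def by (auto simp: indicator_def field_simps)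
  qed auto
  also have "\<dots> = B / real N" by simp
  finally show ?thesis unfolding inner .
qed

section \<open>Fundamental domains and the covolume of the integer lattice\<close>

lemma countable_int_lattice: "countable (\<int> \<times> \<int> :: (real \<times> real) set)"
  unfolding Ints_def by (intro countable_SIGMA countable_image) auto

lemma emeasure_translate_vimage:
  fixes c :: "'a::euclidean_space"
  assumes "A \<in> sets borel"
  shows "emeasure lborel ((+) c -` A) = emeasure lborel A"
proof -
  have "emeasure (distr lborel borel ((+) c)) A = emeasure lborel ((+) c -` A)"
    using assms by (subst emeasure_distr) auto
  then show ?thesis by (simp add: lborel_distr_plus)
qed

text \<open>The translates \<open>l + E\<close>, written as preimages under
  \<open>(+) (- l)\<close>, tile the plane and so cut \<open>D\<close> into countably many disjoint
  pieces.\<close>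

lemma fundamental_domain_emeasure_decomp:
  assumes \<Lambda>: "countable \<Lambda>" and D: "D \<in> sets borel" and E: "fundamental_domain \<Lambda> E"
  shows "emeasure lborel D = (\<integral>\<^sup>+l. emeasure lborel (D \<inter> (+) (- l) -` E) \<partial>count_space \<Lambda>)"
proof -
  have E': "E \<in> sets borel" using E by (simp add: fundamental_domain_def)
  have ex: "\<exists>!l. l \<in> \<Lambda> \<and> - l + x \<in> E" for x
    using E unfolding fundamental_domain_def by (simp del: split_paired_All)
  have meas: "D \<inter> (+) (- l) -` E \<in> sets lborel" for l
    using D measurable_sets[of "(+) (- l)" borel borel E] E' by auto
  have "D = (\<Union>l\<in>\<Lambda>. D \<inter> (+) (- l) -` E)" using ex by auto blast
  moreover have "disjoint_family_on (\<lambda>l. D \<inter> (+) (- l) -` E) \<Lambda>"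
    unfolding disjoint_family_on_def
  proof (intro ballI impI)
    fix l m assume "l \<in> \<Lambda>" "m \<in> \<Lambda>" "l \<noteq> m"
    then have "\<not> (- l + x \<in> E \<and> - m + x \<in> E)" for x using ex[of x] by blast
    then show "D \<inter> (+) (- l) -` E \<inter> (D \<inter> (+) (- m) -` E) = {}" by blast
  qed
  ultimately show ?thesis
    using emeasure_UN_countable[of \<Lambda> "\<lambda>l. D \<inter> (+) (- l) -` E" lborel] meas \<Lambda> by presburger
qed

text \<open>Cutting \<open>D\<close> by translates of \<open>E\<close>, and \<open>E\<close> by
  translates of \<open>D\<close>, gives pieces that correspond under translation by lattice vectors;
  the symmetry of \<Lambda> matches the two indexings. This provides the uniqueness behind
  \<open>THE\<close> in \<open>covolume\<close>.\<close>

lemma fundamental_domains_emeasure_eq: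
  assumes \<Lambda>: "countable \<Lambda>" "uminus ` \<Lambda> = \<Lambda>"
    and D: "fundamental_domain \<Lambda> D" and E: "fundamental_domain \<Lambda> E"
  shows "emeasure lborel D = emeasure lborel E"
proof -
  have D': "D \<in> sets borel" and E': "E \<in> sets borel"
    using D E by (auto simp: fundamental_domain_def)
  have bij: "bij_betw uminus \<Lambda> \<Lambda>" using \<Lambda>(2) by (simp add: bij_betw_def)
  have shift: "emeasure lborel (D \<inter> (+) (- l) -` E) = emeasure lborel (E \<inter> (+) l -` D)" for l
  proof -
    have "D \<inter> (+) (- l) -` E \<in> sets borel"
      using D' measurable_sets[of "(+) (- l)" borel borel E] E' by auto
    from emeasure_translate_vimage[OF this, of l] show ?thesis
      by (simp add: vimage_Int vimage_comp comp_def Int_commute)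
  qed
  have "emeasure lborel D = (\<integral>\<^sup>+l. emeasure lborel (E \<inter> (+) l -` D) \<partial>count_space \<Lambda>)"
    using fundamental_domain_emeasure_decomp[OF \<Lambda>(1) D' E] by (simp add: shift)
  also have "\<dots> = (\<integral>\<^sup>+l. emeasure lborel (E \<inter> (+) (- l) -` D) \<partial>count_space \<Lambda>)"
    using nn_integral_bij_count_space[OF bij, of "\<lambda>l. emeasure lborel (E \<inter> (+) l -` D)"] by simp
  also have "\<dots> = emeasure lborel E"
    by (rule fundamental_domain_emeasure_decomp[OF \<Lambda>(1) E' D, symmetric])
  finally show ?thesis .
qed

lemma unit_square_fundamental_domain:
  "fundamental_domain (\<int> \<times> \<int>) ({0..<1} \<times> {0..<1})"
  unfolding fundamental_domain_def
proof (intro conjI allI)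
  show "{0..<1::real} \<times> {0..<1::real} \<in> sets borel"
    by (intro borel_Times) auto
next
  fix p :: "real \<times> real"
  obtain x y where p: "p = (x, y)" by (cases p)
  show "\<exists>!l. l \<in> \<int> \<times> \<int> \<and> p - l \<in> {0..<1} \<times> {0..<1}"
  proof (rule ex1I[of _ "(of_int \<lfloor>x\<rfloor>, of_int \<lfloor>y\<rfloor>)"])
    show "(of_int \<lfloor>x\<rfloor>, of_int \<lfloor>y\<rfloor>) \<in> \<int> \<times> \<int> \<and> p - (of_int \<lfloor>x\<rfloor>, of_int \<lfloor>y\<rfloor>) \<in> {0..<1} \<times> {0..<1}"
      unfolding p by (auto simp: frac_lt_1 simp flip: frac_def)
  next
    fix l assume "l \<in> \<int> \<times> \<int> \<and> p - l \<in> {0..<1} \<times> {0..<1}"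
    then show "l = (of_int \<lfloor>x\<rfloor>, of_int \<lfloor>y\<rfloor>)"
      unfolding p by (auto elim!: Ints_cases simp: floor_unique)
  qed
qed

lemma emeasure_unit_square: "emeasure lborel ({0..<1::real} \<times> {0..<1::real}) = 1"
  unfolding lborel_prod[symmetric] by (subst lborel.emeasure_pair_measure_Times) auto

lemma covolume_int: "covolume (\<int> \<times> \<int>) = 1"
proof -
  have sym: "uminus ` (\<int> \<times> \<int> :: (real \<times> real) set) = \<int> \<times> \<int>"
    by (auto simp: image_iff) (metis Ints_minus minus_minus)+
  have "measure lborel D = 1" if "fundamental_domain (\<int> \<times> \<int>) D" for D
    using fundamental_domains_emeasure_eq[OF countable_int_lattice sym that unit_square_fundamental_domain]
    by (simp add: emeasure_unit_square measure_def)
  then show ?thesis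
    unfolding covolume_def using unit_square_fundamental_domain by (intro the_equality) fastforce+
qed

lemma is_lattice_int: "is_lattice (\<int> \<times> \<int>)"
  unfolding is_lattice_def
proof (intro exI conjI)
  show "(1, 0) \<noteq> (0, 1 :: real)" by simp
  have "(1, 0) \<notin> span {(0 :: real, 1 :: real)}"
    by (auto simp: span_singleton)
  then show "independent {(1, 0), (0 :: real, 1 :: real)}"
    by (auto simp: independent_insert zero_prod_def)
  show "\<int> \<times> \<int> = {of_int k *\<^sub>R (1 :: real, 0 :: real) + of_int l *\<^sub>R (0 :: real, 1 :: real) | k l :: int. True}"
    by (auto elim!: Ints_cases)
qed

section \<open>Explicit form and decay of the first Hermite function\<close>

lemma hermite_fun_1:
  "hermite_fun 1 t = complex_of_real (4 * pi * hermite_const 1 * t * exp (- pi * t\<^sup>2))"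
proof -
  have "((\<lambda>s::real. exp (- 2 * pi * s\<^sup>2)) has_real_derivative - 4 * pi * t * exp (- 2 * pi * t\<^sup>2)) (at t)"
    by (auto intro!: derivative_eq_intros)
  then have "deriv (\<lambda>s::real. exp (- 2 * pi * s\<^sup>2)) t = - 4 * pi * t * exp (- 2 * pi * t\<^sup>2)"
    by (rule DERIV_imp_deriv)
  moreover have "exp (pi * t\<^sup>2) * exp (- 2 * pi * t\<^sup>2) = exp (- pi * t\<^sup>2)"
    by (simp flip: exp_add)
  ultimately show ?thesis
    unfolding hermite_fun_def by (simp add: mult_ac)
qed

text \<open>The term \<open>2 * \<bar>t\<bar>\<close> makes room for a polynomial factor up to
  \<open>(1 + \<bar>t\<bar>)\<^sup>2\<close>, and the slack 2 in the hypothesis for arguments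
  \<open>t\<close> near, but not equal to, the integer \<open>i\<close>.\<close>

lemma exp_neg_square_le_half_power:
  fixes t :: real
  assumes "\<bar>of_int i\<bar> \<le> \<bar>t\<bar> + 2"
  shows "exp (2 * \<bar>t\<bar> - t\<^sup>2) \<le> exp 5 * (1/2) ^ nat \<bar>i\<bar>"
proof -
  \<comment> \<open>This says \<open>t\<^sup>2 \<ge> 3 * \<bar>t\<bar> - 9/4\<close>, so the
    exponent is at most \<open>9/4 - \<bar>t\<bar> \<le> 17/4 - \<bar>of_int i\<bar>\<close>, and
    17/4 is rounded up to 5.\<close>
  have "0 \<le> (2 * \<bar>t\<bar> - 3)\<^sup>2" by simp
  then have "2 * \<bar>t\<bar> - t\<^sup>2 \<le> 5 - \<bar>of_int i\<bar>"
    using assms by (simp add: power2_eq_square algebra_simps)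
  then have "exp (2 * \<bar>t\<bar> - t\<^sup>2) \<le> exp 5 * exp (- \<bar>of_int i\<bar>)"
    by (simp flip: exp_add)
  also have "exp (- \<bar>of_int i\<bar>) = exp (-1 :: real) ^ nat \<bar>i\<bar>"
    by (simp flip: exp_of_nat_mult)
  also have "exp 5 * exp (-1 :: real) ^ nat \<bar>i\<bar> \<le> exp 5 * (1/2) ^ nat \<bar>i\<bar>"
    using exp_ge_add_one_self[of "1::real"]
    by (intro mult_left_mono power_mono) (auto simp: exp_minus field_simps)
  finally show ?thesis .
qed

text \<open>Both \<open>G\<close> and its derivative are a polynomial of degree at most 2 times a
  Gaussian, and the mean value theorem turns the bound for the derivative into the Lipschitz bound.
  In the common constant, \<open>2 * pi * \<bar>c\<bar>\<close> comes from the coefficients of the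
  derivative.\<close>

lemma odd_gaussian_decay:
  fixes c :: real
  defines "G \<equiv> \<lambda>t. c * t * exp (- pi * t\<^sup>2)"
  assumes x: "0 \<le> x" "x \<le> 1"
  obtains C where "\<And>i::int. \<bar>G (of_int i - x)\<bar> \<le> C * (1/2) ^ nat \<bar>i\<bar>"
    and "\<And>(i::int) t. 0 \<le> t \<Longrightarrow> t \<le> 1 \<Longrightarrow>
      \<bar>G (t + of_int i - x) - G (of_int i - x)\<bar> \<le> C * t * (1/2) ^ nat \<bar>i\<bar>"
proof
  define G' where "G' t = c * (1 - 2 * pi * t\<^sup>2) * exp (- pi * t\<^sup>2)" for t
  let ?C = "2 * pi * \<bar>c\<bar> * exp 5"
  have pi1: "1 \<le> pi" using pi_gt3 by simp
  have poly: "q * exp (- pi * t\<^sup>2) \<le> exp 5 * (1/2) ^ nat \<bar>i\<bar>"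
    if "0 \<le> q" "q \<le> (1 + \<bar>t\<bar>)\<^sup>2" "\<bar>of_int i\<bar> \<le> \<bar>t\<bar> + 2" for t q :: real and i
  proof -
    have "q \<le> exp \<bar>t\<bar> ^ 2"
      by (intro order_trans[OF that(2)] power_mono exp_ge_add_one_self) auto
    moreover have "exp (- pi * t\<^sup>2) \<le> exp (- t\<^sup>2)"
      using mult_right_mono[OF pi1, of "t\<^sup>2"] by simp
    ultimately have "q * exp (- pi * t\<^sup>2) \<le> exp \<bar>t\<bar> ^ 2 * exp (- t\<^sup>2)"
      using that(1) by (intro mult_mono) auto
    also have "\<dots> = exp (2 * \<bar>t\<bar> - t\<^sup>2)"
      by (simp add: exp_diff exp_minus exp_double divide_inverse)
    finally show ?thesis using exp_neg_square_le_half_power[OF that(3)] by linarith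
  qed
  show "\<bar>G (of_int i - x)\<bar> \<le> ?C * (1/2) ^ nat \<bar>i\<bar>" for i :: int
  proof -
    let ?t = "of_int i - x"
    have "\<bar>?t\<bar> * exp (- pi * ?t\<^sup>2) \<le> exp 5 * (1/2) ^ nat \<bar>i\<bar>"
    proof (rule poly)
      have "0 \<le> \<bar>?t\<bar> + \<bar>?t\<bar>\<^sup>2" by simp
      then show "\<bar>?t\<bar> \<le> (1 + \<bar>?t\<bar>)\<^sup>2" by (simp only: power2_eq_square distrib_left distrib_right) simp
      show "\<bar>of_int i\<bar> \<le> \<bar>?t\<bar> + 2" using x by linarith
    qed simp
    then have "\<bar>c\<bar> * (\<bar>?t\<bar> * exp (- pi * ?t\<^sup>2)) \<le> \<bar>c\<bar> * (exp 5 * (1/2) ^ nat \<bar>i\<bar>)"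
      by (intro mult_left_mono) auto
    also have "\<dots> \<le> (2 * pi) * (\<bar>c\<bar> * (exp 5 * (1/2) ^ nat \<bar>i\<bar>))"
      using pi1 mult_right_mono[of 1 "2 * pi" "\<bar>c\<bar> * (exp 5 * (1/2) ^ nat \<bar>i\<bar>)"] by simp
    finally show ?thesis by (simp add: G_def abs_mult mult_ac)
  qed
  have G'_le: "\<bar>G' t\<bar> \<le> ?C * (1/2) ^ nat \<bar>i\<bar>" if "\<bar>of_int i\<bar> \<le> \<bar>t\<bar> + 2" for t and i :: int
  proof -
    have "\<bar>1 - 2 * pi * t\<^sup>2\<bar> \<le> 1 + 2 * pi * t\<^sup>2" by (auto simp: abs_le_iff)
    also have "\<dots> \<le> 2 * pi * (1 + t\<^sup>2)" using pi1 by (simp add: algebra_simps)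
    finally have "\<bar>G' t\<bar> \<le> \<bar>c\<bar> * (2 * pi * (1 + t\<^sup>2)) * exp (- pi * t\<^sup>2)"
      unfolding G'_def abs_mult by (intro mult_mono) auto
    also have "\<dots> = 2 * pi * \<bar>c\<bar> * ((1 + t\<^sup>2) * exp (- pi * t\<^sup>2))" by simp
    also have "\<dots> \<le> 2 * pi * \<bar>c\<bar> * (exp 5 * (1/2) ^ nat \<bar>i\<bar>)"
      using that by (intro mult_left_mono poly) (auto simp: power2_eq_square algebra_simps)
    finally show ?thesis by (simp add: mult_ac)
  qed
  show "\<bar>G (t + of_int i - x) - G (of_int i - x)\<bar> \<le> ?C * t * (1/2) ^ nat \<bar>i\<bar>"
    if t: "0 \<le> t" "t \<le> 1" for i :: int and t
  proof (cases "t = 0")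
    case False
    have D: "(G has_real_derivative G' y) (at y)" for y
      unfolding G_def G'_def by (auto intro!: derivative_eq_intros simp: power2_eq_square algebra_simps)
    have "of_int i - x < t + of_int i - x" using t False by simp
    from MVT2[OF this, of G G'] D obtain y
      where y: "of_int i - x < y" "y < t + of_int i - x"
        "G (t + of_int i - x) - G (of_int i - x) = t * G' y" by auto
    \<comment> \<open>The intermediate point satisfies
      \<open>\<bar>y - of_int i\<bar> \<le> 1\<close>, since \<open>x\<close> and \<open>t\<close>
      lie in \<open>[0, 1]\<close>; hence the weight can be centred at \<open>i\<close>.\<close>
    have "\<bar>t * G' y\<bar> \<le> t * (?C * (1/2) ^ nat \<bar>i\<bar>)"
      unfolding abs_mult using t x y(1,2) by (intro mult_mono G'_le) auto
    then show ?thesis unfolding y(3) by (simp add: mult_ac)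
  qed simp
qed

section \<open>Coefficient sums over the configuration and failure of the lower frame bound\<close>

text \<open>In \<open>ennreal\<close> an infinite sum is the supremum of its finite partial sums,
  and a finite part of one translate of the lattice fits into a box
  \<open>K \<times> L\<close>.\<close>

lemma infsum_lattice_translates_le:
  fixes h :: "real \<times> real \<Rightarrow> ennreal"
  assumes M: "finite M"
    and bound: "\<And>m K L. m \<in> M \<Longrightarrow> finite K \<Longrightarrow> finite L \<Longrightarrow>
      (\<Sum>k\<in>K. \<Sum>l\<in>L. h (of_int k + fst (z m), of_int l + snd (z m))) \<le> c m"
  shows "infsum h (\<Union>m\<in>M. (\<lambda>l. l + z m) ` (\<int> \<times> \<int>)) \<le> (\<Sum>m\<in>M. c m)"
proof (rule infsum_le_finite_sums)
  fix F assume F: "finite F" "F \<subseteq> (\<Union>m\<in>M. (\<lambda>l. l + z m) ` (\<int> \<times> \<int>))"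
  let ?T = "\<lambda>m. (\<lambda>l. l + z m) ` (\<int> \<times> \<int>)"
  have part: "(\<Sum>p\<in>F \<inter> ?T m. h p) \<le> c m" if m: "m \<in> M" for m
  proof -
    define P where "P = (\<lambda>(k, l). (of_int k + fst (z m), of_int l + snd (z m)) :: real \<times> real)"
    \<comment> \<open>On points of the translate by \<open>z m\<close> the floors recover the
      integer coordinates; other points of \<open>F\<close> merely enlarge the box, harmlessly
      because \<open>h\<close> is nonnegative.\<close>
    define K where "K = (\<lambda>p. \<lfloor>fst p - fst (z m)\<rfloor>) ` F"
    define L where "L = (\<lambda>p. \<lfloor>snd p - snd (z m)\<rfloor>) ` F"
    have KL: "finite K" "finite L" using F by (auto simp: K_def L_def)
    have inj: "inj_on P (K \<times> L)" unfolding P_def inj_on_def by auto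
    have "F \<inter> ?T m \<subseteq> P ` (K \<times> L)"
    proof
      fix p assume p: "p \<in> F \<inter> ?T m"
      then obtain k l :: int where kl: "p = (of_int k, of_int l) + z m"
        by (auto elim!: Ints_cases)
      then have "k = \<lfloor>fst p - fst (z m)\<rfloor>" "l = \<lfloor>snd p - snd (z m)\<rfloor>" by auto
      then have "k \<in> K" "l \<in> L" using p unfolding K_def L_def by auto
      moreover have "p = P (k, l)" unfolding P_def kl by (auto simp: prod_eq_iff)
      ultimately show "p \<in> P ` (K \<times> L)" by blast
    qed
    then have "(\<Sum>p\<in>F \<inter> ?T m. h p) \<le> (\<Sum>p\<in>P ` (K \<times> L). h p)"
      using KL by (intro sum_mono2) auto
    also have "\<dots> = (\<Sum>k\<in>K. \<Sum>l\<in>L. h (P (k, l)))"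
      by (simp add: sum.reindex[OF inj] sum.cartesian_product)
    also have "\<dots> \<le> c m" unfolding P_def using bound[OF m KL] by simp
    finally show ?thesis .
  qed
  \<comment> \<open>Each point is charged to every translate containing it, so overlaps could only
    increase the right-hand side.\<close>
  have "(\<Sum>p\<in>F. h p) \<le> (\<Sum>p\<in>F. \<Sum>m\<in>M. if p \<in> ?T m then h p else 0)"
  proof (rule sum_mono)
    fix p assume "p \<in> F"
    then obtain m where m: "m \<in> M" "p \<in> ?T m" using F by blast
    have "(if p \<in> ?T m then h p else 0) \<le> (\<Sum>m\<in>M. if p \<in> ?T m then h p else 0)"
      using M m by (intro member_le_sum) auto
    then show "h p \<le> (\<Sum>m\<in>M. if p \<in> ?T m then h p else 0)" using m by simp
  qed
  also have "\<dots> = (\<Sum>m\<in>M. \<Sum>p\<in>F \<inter> ?T m. h p)"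
    by (subst sum.swap) (simp only: sum.inter_restrict[OF F(1)])
  also have "\<dots> \<le> (\<Sum>m\<in>M. c m)" by (intro sum_mono part)
  finally show "sum h F \<le> (\<Sum>m\<in>M. c m)" .
qed (simp add: nonneg_summable_on_complete)

lemma gabor_hermite_1_translate_bound:
  assumes par: "(x, \<omega>) \<in> {(0, 0), (1/2, 0), (0, 1/2)}"
  obtains B where "\<And>(N::nat) (K::int set) (L::int set). 1 \<le> N \<Longrightarrow> finite K \<Longrightarrow> finite L \<Longrightarrow>
    (\<Sum>k\<in>K. \<Sum>l\<in>L. (cmod (L2_inner (\<lambda>t. \<Sum>j<N. indicator {real j..real j + 1 / real N} t)
      (tf_shift (of_int k + x, of_int l + \<omega>) (hermite_fun 1))))\<^sup>2) \<le> B / real N"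
proof -
  define G where "G = (\<lambda>t. 4 * pi * hermite_const 1 * t * exp (- pi * t\<^sup>2))"
  have G: "hermite_fun 1 = (\<lambda>t. complex_of_real (G t))"
    unfolding G_def by (rule ext) (rule hermite_fun_1)
  define s :: int where "s = (if x = 0 then 0 else 1)"
  define \<sigma> :: real where "\<sigma> = (if \<omega> = 0 then 1 else -1)"
  have "0 \<le> x" "x \<le> 1" using par by auto
  then obtain C where C: "\<And>i::int. \<bar>G (of_int i - x)\<bar> \<le> C * (1/2) ^ nat \<bar>i\<bar>"
    "\<And>(i::int) t. 0 \<le> t \<Longrightarrow> t \<le> 1 \<Longrightarrow>
      \<bar>G (t + of_int i - x) - G (of_int i - x)\<bar> \<le> C * t * (1/2) ^ nat \<bar>i\<bar>"
    using odd_gaussian_decay[of x "4 * pi * hermite_const 1"] unfolding G_def by blast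
  have odd: "G (- t) = - G t" for t by (simp add: G_def)
  \<comment> \<open>At each of the three points \<open>x = 0\<close> or \<open>\<omega> = 0\<close>,
    so \<open>s = 0\<close> or \<open>\<sigma> = 1\<close>, which gives
    \<open>\<sigma> powi s = 1\<close>.\<close>
  have s: "s = 0 \<or> s = 1" "\<sigma> = 1 \<or> \<sigma> = -1" "\<sigma> powi s = 1" "2 * x = of_int s"
    using par by (auto simp: s_def \<sigma>_def)
  obtain B where B: "\<And>(N::nat) (K::int set) t. 1 \<le> N \<Longrightarrow> finite K \<Longrightarrow> 0 \<le> t \<Longrightarrow> t * real N \<le> 1 \<Longrightarrow>
    (\<Sum>k\<in>K. (\<Sum>j<N. \<sigma> ^ j * G (t + real j - of_int k - x))\<^sup>2) \<le> B"
    using alternating_translates_sum_squares_bound[OF odd s C] by blast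
  have \<sigma>: "cnj (exp (2 * of_real pi * \<i> * of_real \<omega>)) = complex_of_real \<sigma>"
  proof (cases "\<omega> = 0")
    case False
    then have \<omega>: "\<omega> = 1/2" using par by auto
    have e: "2 * of_real pi * \<i> * of_real \<omega> = of_real pi * \<i>" unfolding \<omega> by simp
    show ?thesis unfolding e exp_pi_i using False by (simp add: \<sigma>_def)
  qed (simp add: \<sigma>_def)
  have cont: "continuous_on UNIV G" unfolding G_def by (intro continuous_intros)
  show ?thesis
  proof (rule that)
    fix N :: nat and K L :: "int set"
    assume "1 \<le> N" "finite K" "finite L"
    then show "(\<Sum>k\<in>K. \<Sum>l\<in>L. (cmod (L2_inner (\<lambda>t. \<Sum>j<N. indicator {real j..real j + 1 / real N} t)
      (tf_shift (of_int k + x, of_int l + \<omega>) (hermite_fun 1))))\<^sup>2) \<le> B / real N"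
      unfolding G by (intro sum_gabor_coefficients_indicator_le[OF cont _ _ _ \<sigma>] B)
  qed
qed

text \<open>The number \<open>n\<close> of intervals containing \<open>t\<close> is a natural
  number, so \<open>n \<le> n\<^sup>2\<close>, and the squared norm is at least the total length
  \<open>N * (1 / N) = 1\<close>.\<close>

lemma sum_indicators_L2:
  assumes "1 \<le> N"
  shows "(\<lambda>t. \<Sum>j<N. indicator {real j..real j + 1 / real N} t) \<in> L2" (is "?f \<in> _")
    and "1 \<le> (L2_norm (\<lambda>t. \<Sum>j<N. indicator {real j..real j + 1 / real N} t))\<^sup>2"
proof -
  let ?I = "\<lambda>j. {real j..real j + 1 / real N}"
  have sq: "(cmod (?f t))\<^sup>2 = (\<Sum>j<N. indicat_real (?I j) t)\<^sup>2" for t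
  proof -
    have "?f t = of_real (\<Sum>j<N. indicat_real (?I j) t)"
      by (simp add: indicator_def of_real_sum)
    then show ?thesis by (simp only: norm_of_real power2_abs)
  qed
  have int1: "integrable lborel (indicat_real (?I j))" for j by simp
  have int: "integrable lborel (\<lambda>t. (cmod (?f t))\<^sup>2)"
    unfolding sq unfolding power2_eq_square sum_product indicator_inter_arith[symmetric]
    by (intro Bochner_Integration.integrable_sum integrable_real_indicator)
      (auto simp: emeasure_lborel_Icc_eq)
  then show "?f \<in> L2" unfolding L2_def by auto
  have ge: "(\<Sum>j<N. indicat_real (?I j) t) \<le> (cmod (?f t))\<^sup>2" for t
  proof -
    define n :: nat where "n = (\<Sum>j<N. indicator (?I j) t)"
    have "(\<Sum>j<N. indicat_real (?I j) t) = real n" by (simp add: n_def indicator_def)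
    moreover have "real n \<le> (real n)\<^sup>2"
      using power2_nat_le_imp_le[of n "n\<^sup>2"] by (cases n) (auto simp: power2_eq_square)
    ultimately show ?thesis unfolding sq by simp
  qed
  have "1 = (\<Sum>j<N. LINT t|lborel. indicat_real (?I j) t)" using assms by simp
  also have "\<dots> = (LINT t|lborel. (\<Sum>j<N. indicat_real (?I j) t))"
    by (intro Bochner_Integration.integral_sum[symmetric] int1)
  also have "\<dots> \<le> (LINT t|lborel. (cmod (?f t))\<^sup>2)"
    by (intro integral_mono Bochner_Integration.integrable_sum int1 int ge)
  also have "\<dots> = (L2_norm ?f)\<^sup>2" unfolding L2_norm_def by simp
  finally show "1 \<le> (L2_norm ?f)\<^sup>2" .
qed

lemma not_gabor_frame_hermite_1:
  fixes z :: "nat \<Rightarrow> real \<times> real"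
  assumes z: "\<And>m. m \<in> M \<Longrightarrow> z m \<in> {(0, 0), (1/2, 0), (0, 1/2)}" and M: "finite M"
  shows "\<not> gabor_frame (hermite_fun 1) (\<Union>m\<in>M. (\<lambda>l. l + z m) ` (\<int> \<times> \<int>))"
proof
  assume "gabor_frame (hermite_fun 1) (\<Union>m\<in>M. (\<lambda>l. l + z m) ` (\<int> \<times> \<int>))"
  then obtain A where A: "0 < A" and frame: "\<And>f. f \<in> L2 \<Longrightarrow> ennreal (A * (L2_norm f)\<^sup>2)
      \<le> (\<Sum>\<^sub>\<infinity>\<gamma>\<in>(\<Union>m\<in>M. (\<lambda>l. l + z m) ` (\<int> \<times> \<int>)). ennreal ((cmod (L2_inner f (tf_shift \<gamma> (hermite_fun 1))))\<^sup>2))"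
    unfolding gabor_frame_def by blast
  define f :: "nat \<Rightarrow> real \<Rightarrow> complex"
    where "f N = (\<lambda>t. \<Sum>j<N. indicator {real j..real j + 1 / real N} t)" for N
  define S where "S m N K L = (\<Sum>k\<in>K. \<Sum>l\<in>L. (cmod (L2_inner (f N)
      (tf_shift (of_int k + fst (z m), of_int l + snd (z m)) (hermite_fun 1))))\<^sup>2)"
    for m N and K L :: "int set"
  have "\<exists>B. \<forall>N K L. 1 \<le> N \<longrightarrow> finite K \<longrightarrow> finite L \<longrightarrow> S m N K L \<le> B / real N" if m: "m \<in> M" for m
  proof -
    have "(fst (z m), snd (z m)) \<in> {(0, 0), (1/2, 0), (0, 1/2)}" using z[OF m] by simp
    then show ?thesis unfolding S_def f_def by (rule gabor_hermite_1_translate_bound) blast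
  qed
  then have "\<forall>m\<in>M. \<exists>B. \<forall>N K L. 1 \<le> N \<longrightarrow> finite K \<longrightarrow> finite L \<longrightarrow> S m N K L \<le> B / real N"
    by blast
  from bchoice[OF this] obtain B where B: "\<forall>m\<in>M. \<forall>N K L. 1 \<le> N \<longrightarrow> finite K \<longrightarrow> finite L \<longrightarrow>
      S m N K L \<le> B m / real N" ..
  \<comment> \<open>With empty index sets and \<open>N = 1\<close> the coefficient bound reads
    \<open>0 \<le> B m\<close>, which the passage from \<open>ennreal\<close> back to the reals
    relies on.\<close>
  have B0: "0 \<le> B m" if "m \<in> M" for m using bspec[OF B that, rule_format, of 1 "{}" "{}"] by (simp add: S_def)
  have le: "A \<le> (\<Sum>m\<in>M. B m) / real N" if N: "1 \<le> N" for N :: nat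
  proof -
    have "ennreal A \<le> ennreal (A * (L2_norm (f N))\<^sup>2)"
      using sum_indicators_L2(2)[OF N] A unfolding f_def by (intro ennreal_leI) simp
    also have "\<dots> \<le> (\<Sum>m\<in>M. ennreal (B m / real N))"
    proof (intro order_trans[OF frame] infsum_lattice_translates_le M)
      show "f N \<in> L2" unfolding f_def by (rule sum_indicators_L2(1)[OF N])
    next
      fix m and K L :: "int set" assume "m \<in> M" "finite K" "finite L"
      then show "(\<Sum>k\<in>K. \<Sum>l\<in>L. ennreal ((cmod (L2_inner (f N) (tf_shift
          (of_int k + fst (z m), of_int l + snd (z m)) (hermite_fun 1))))\<^sup>2)) \<le> ennreal (B m / real N)"
        using bspec[OF B, rule_format, of m N K L] N unfolding S_def by (simp add: sum_nonneg ennreal_leI)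
    qed
    also have "\<dots> = ennreal ((\<Sum>m\<in>M. B m) / real N)"
      using B0 by (simp add: sum_divide_distrib)
    finally show ?thesis using B0 by (simp add: sum_nonneg)
  qed
  \<comment> \<open>For large \<open>N\<close> the upper estimate drops below \<open>A\<close>;
    \<open>Suc N\<close> guarantees a positive index.\<close>
  obtain N :: nat where "(\<Sum>m\<in>M. B m) / A < real N" using reals_Archimedean2 by blast
  then have "(\<Sum>m\<in>M. B m) / real (Suc N) < A" using A by (simp add: field_simps)
  with le[of "Suc N"] show False by simp
qed

theorem theorem3p4:
  fixes z :: "nat \<Rightarrow> real \<times> real" and \<Gamma> :: "(real \<times> real) set"
  assumes "z 1 = (0, 0)" and "z 2 = (1/2, 0)" and "z 3 = (0, 1/2)"
    and "\<Gamma> = (\<Union>m\<in>{1..3}. (\<lambda>l. l + z m) ` (\<int> \<times> \<int>))"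
  shows "periodic_configuration (\<int> \<times> \<int>) 3 z \<Gamma> \<and> config_density (\<int> \<times> \<int>) 3 = 3
    \<and> \<not> gabor_frame (hermite_fun 1) \<Gamma>"
proof (intro conjI)
  have M: "{1..3} = {1, 2, 3 :: nat}" by auto
  \<comment> \<open>Any two distinct points among the three differ by 1/2 or -1/2 in some
    coordinate.\<close>
  have half: "1/2 \<notin> (\<int> :: real set)" "- (1/2) \<notin> (\<int> :: real set)"
    by (auto elim!: Ints_cases simp: field_simps)
  show "periodic_configuration (\<int> \<times> \<int>) 3 z \<Gamma>"
    unfolding periodic_configuration_def M
  proof (intro conjI is_lattice_int)
    show "\<forall>i\<in>{1, 2, 3}. \<forall>j\<in>{1, 2, 3}. i \<noteq> j \<longrightarrow> z i - z j \<notin> \<int> \<times> \<int>"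
      unfolding ball_simps assms(1-3) using half by simp
    show "\<Gamma> = (\<Union>m\<in>{1, 2, 3}. (\<lambda>l. l + z m) ` (\<int> \<times> \<int>))"
      using assms(4) unfolding M .
  qed
  show "config_density (\<int> \<times> \<int>) 3 = 3"
    by (simp add: config_density_def covolume_int)
  show "\<not> gabor_frame (hermite_fun 1) \<Gamma>"
    unfolding assms(4) M using assms(1-3) by (intro not_gabor_frame_hermite_1) auto
qed

end
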